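(* Let $\Phi=[-B,B]^{d_1}$ and $\Psi=[-B,B]^{d-d_1}$ with a constant $B>0$, and for $\phi\in\Phi$, $\psi\in\Psi$ let $$p_{\phi,\psi}(\boldsymbol x\vert k)=(2\pi)^{-d/2}e^{-\frac12\|\boldsymbol x-(\phi,\psi)\|_2^2},\qquad \boldsymbol x\in\mathbb R^d,\ k\in\{1,\dots,K\}.$$ Let the true conditional distributions be $p^*_{X\vert k}=p_{\phi_k^*,\psi^*}(\cdot\vert k)$ with $\phi_k^*\in\Phi$ for all $k$ and $\psi^*\in\Psi$, let $S=\{(\boldsymbol x_i,y_i)\}_{i=1}^n$ be i.i.d. from $p^*_{X,Y}=p^*_{X\vert Y}p^*_Y$, and let $\hat p^{\mathrm{single}}_{X\vert Y}$ be a maximizer of $\mathcal L_S(p_{X\vert Y})=\prod_{i=1}^n p_{X\vert Y}(\boldsymbol x_i\vert y_i)$ over $$\mathcal P^{\mathrm{single}}_{X\vert Y}=\Big\{\textstyle\prod_{k=1}^K (p_{\phi_k,\psi_k}(\boldsymbol x\vert k))^{\mathbb I(y=k)}:\phi_1,\dots,\phi_K\in\Phi,\ \psi_1,\dots,\psi_K\in\Psi\Big\}.$$ Then for any $0<\delta\le1/2$, with probability at least $1-\delta$, $$\mathcal R_{\overline{\mathrm{TV}}}(\hat p^{\mathrm{single}}_{X\vert Y})=\tilde{\mathcal O}\left(\sqrt{\frac{Kd}{n}}\right).$$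
   Context: $\mathscr X=\mathbb R^d$, $\mathscr Y=\{1,\dots,K\}$, $d_1\le d$; $p_Y^*$ is a distribution on $\mathscr Y$; $(\phi,\psi)\in\mathbb R^d$ is the concatenation; $\mathbb I$ is the indicator function. Average TV error: $\mathcal R_{\overline{\mathrm{TV}}}(\hat p_{X\vert Y})=\mathbb E_{Y\sim p_Y^*}\left[\frac12\int_{\mathscr X}\left|\hat p_{X\vert Y}(\boldsymbol x\vert Y)-p^*_{X\vert Y}(\boldsymbol x\vert Y)\right|d\boldsymbol x\right]$. $\tilde{\mathcal O}(b)$ means bounded above by $b$ up to absolute constants and logarithmic factors: there are absolute constants $C,c>0$ such that the left-hand side is at most $C\,b\,(\log(2+n+K+d+B+1/\delta))^{c}$. *)

theory Defs
  imports "HOL-Probability.Probability"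
begin

text \<open>The constants hidden in the rate must not depend on the dimension \<open>d\<close>, so \<open>d\<close> has to be
  quantified inside the statement and cannot be a type. Points of $\mathbb R^d$ are therefore
  functions on \<open>{..<d}\<close>, carrying the product Lebesgue measure.\<close>

definition lborel_dim :: "nat \<Rightarrow> (nat \<Rightarrow> real) measure" where
  "lborel_dim d = Pi\<^sub>M {..<d} (\<lambda>_. lborel)"

definition cube :: "nat \<Rightarrow> real \<Rightarrow> (nat \<Rightarrow> real) set" where
  "cube m B = {..<m} \<rightarrow>\<^sub>E {- B..B}"

definition vec_concat :: "nat \<Rightarrow> (nat \<Rightarrow> real) \<Rightarrow> (nat \<Rightarrow> real) \<Rightarrow> nat \<Rightarrow> real" where
  "vec_concat d1 \<phi> \<psi> i = (if i < d1 then \<phi> i else \<psi> (i - d1))"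

text \<open>Conditional densities \<open>p(x | k)\<close> are functions taking \<open>x\<close> first and the label \<open>k\<close> second.
  The Gaussian one depends on \<open>k\<close> only through the parameters that are later chosen per class.\<close>

type_synonym cond_density = "(nat \<Rightarrow> real) \<Rightarrow> nat \<Rightarrow> real"

definition gauss_cond ::
    "nat \<Rightarrow> nat \<Rightarrow> (nat \<Rightarrow> real) \<Rightarrow> (nat \<Rightarrow> real) \<Rightarrow> cond_density" where
  "gauss_cond d d1 \<phi> \<psi> x k =
     (2 * pi) powr (- real d / 2) *
     exp (- (1 / 2) * (L2_set (\<lambda>i. x i - vec_concat d1 \<phi> \<psi> i) {..<d})\<^sup>2)"

definition single_class :: "nat \<Rightarrow> nat \<Rightarrow> nat \<Rightarrow> real \<Rightarrow> cond_density set" where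
  "single_class d d1 K B =
     {(\<lambda>x y. \<Prod>k\<in>{1..K}. gauss_cond d d1 (\<phi> k) (\<psi> k) x k ^ of_bool (y = k)) | \<phi> \<psi>.
        (\<forall>k\<in>{1..K}. \<phi> k \<in> cube d1 B) \<and> (\<forall>k\<in>{1..K}. \<psi> k \<in> cube (d - d1) B)}"

definition joint_dist :: "nat \<Rightarrow> nat \<Rightarrow> cond_density \<Rightarrow> nat pmf \<Rightarrow> ((nat \<Rightarrow> real) \<times> nat) measure" where
  "joint_dist d K p pY =
     density (lborel_dim d \<Otimes>\<^sub>M count_space {1..K}) (\<lambda>(x, y). ennreal (p x y * pmf pY y))"

definition sample_dist ::
    "nat \<Rightarrow> nat \<Rightarrow> nat \<Rightarrow> cond_density \<Rightarrow> nat pmf \<Rightarrow> (nat \<Rightarrow> (nat \<Rightarrow> real) \<times> nat) measure" where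
  "sample_dist n d K p pY = Pi\<^sub>M {..<n} (\<lambda>_. joint_dist d K p pY)"

definition likelihood :: "nat \<Rightarrow> (nat \<Rightarrow> (nat \<Rightarrow> real) \<times> nat) \<Rightarrow> cond_density \<Rightarrow> real" where
  "likelihood n S p = (\<Prod>i<n. p (fst (S i)) (snd (S i)))"

definition is_MLE ::
    "nat \<Rightarrow> (nat \<Rightarrow> (nat \<Rightarrow> real) \<times> nat) \<Rightarrow> cond_density set \<Rightarrow> cond_density \<Rightarrow> bool" where
  "is_MLE n S P p \<longleftrightarrow> is_arg_max (likelihood n S) (\<lambda>q. q \<in> P) p"

definition avg_TV :: "nat \<Rightarrow> nat pmf \<Rightarrow> cond_density \<Rightarrow> cond_density \<Rightarrow> real" where
  "avg_TV d pY p q =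
     measure_pmf.expectation pY (\<lambda>k. 1 / 2 * (\<integral>x. \<bar>p x k - q x k\<bar> \<partial>lborel_dim d))"

end

theory Submission imports Defs begin

text \<open>For each class \<open>k\<close>, comparing the maximum likelihood estimator with the competitor that is
  correct on class \<open>k\<close> bounds the distance \<open>r\<close> of the estimated mean from the true one by
  \<open>N r \<le> 2 |T|\<close>, where \<open>N\<close> is the number of samples with label \<open>k\<close> and \<open>T\<close> the sum of their
  deviations from the true mean. Chernoff bounds applied to \<open>\<plusminus> l T\<^sub>j - l\<^sup>2 N / 2\<close> and to \<open>- N\<close>, with
  the deterministic choice \<open>l = sqrt (t / (n p\<^sub>k))\<close>, control \<open>T\<close> and \<open>N\<close> up to \<open>t \<approx> log (K d / \<delta>)\<close>
  and give a total variation error of order \<open>sqrt (d t / (n p\<^sub>k))\<close> in class \<open>k\<close>; for classes with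
  \<open>n p\<^sub>k < 4 t\<close> this holds because the total variation is at most 1. Averaging over the classes,
  \<open>\<Sum> p\<^sub>k / sqrt p\<^sub>k \<le> sqrt K\<close> by Cauchy-Schwarz.\<close>

declare One_nat_def [simp del]

section \<open>Gaussian densities with identity covariance and their total variation
  distance\<close>

definition gauss_density :: "nat \<Rightarrow> (nat \<Rightarrow> real) \<Rightarrow> (nat \<Rightarrow> real) \<Rightarrow> real" where
  "gauss_density d v x = (\<Prod>i<d. normal_density (v i) 1 (x i))"

lemma gauss_density_exp:
  "gauss_density d v x = (2 * pi) powr (- real d / 2) * exp (- (1 / 2) * (\<Sum>i<d. (x i - v i)\<^sup>2))"
proof -
  have "1 / sqrt (2 * pi) = (2 * pi) powr (- 1 / 2)"
    by (simp add: powr_minus powr_half_sqrt inverse_eq_divide)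
  then have "(1 / sqrt (2 * pi)) ^ d = (2 * pi) powr (- real d / 2)"
    by (simp add: powr_powr flip: powr_realpow)
  moreover have "gauss_density d v x = (1 / sqrt (2 * pi)) ^ d * exp (- (1 / 2) * (\<Sum>i<d. (x i - v i)\<^sup>2))"
    by (simp add: gauss_density_def normal_density_def prod_dividef power_one_over sum_distrib_left exp_sum)
  ultimately show ?thesis by simp
qed

lemma gauss_cond_eq: "gauss_cond d d1 \<phi> \<psi> x k = gauss_density d (vec_concat d1 \<phi> \<psi>) x"
  by (simp add: gauss_cond_def gauss_density_exp L2_set_def sum_nonneg)

lemma gauss_density_pos: "gauss_density d v x > 0"
  by (simp add: gauss_density_def prod_pos normal_density_pos)

lemma gauss_density_measurable [measurable]: "gauss_density d v \<in> borel_measurable (lborel_dim d)"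
  unfolding gauss_density_def[abs_def] lborel_dim_def by measurable

text \<open>The product form of \<open>gauss_density\<close> makes the integral over
  \<open>lborel_dim d\<close> factor into \<open>d\<close> one-dimensional normal integrals, each
  equal to 1.\<close>

lemma
  shows integrable_gauss_density: "integrable (lborel_dim d) (gauss_density d v)"
    and integral_gauss_density: "(\<integral>x. gauss_density d v x \<partial>lborel_dim d) = 1"
proof -
  interpret product_sigma_finite "\<lambda>_::nat. lborel :: real measure"
    by (simp add: product_sigma_finite_def sigma_finite_lborel)
  show "integrable (lborel_dim d) (gauss_density d v)"
    unfolding gauss_density_def[abs_def] lborel_dim_def by (intro product_integrable_prod) auto
  show "(\<integral>x. gauss_density d v x \<partial>lborel_dim d) = 1"
    unfolding gauss_density_def[abs_def] lborel_dim_def by (subst product_integral_prod) auto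
qed

lemma nn_integral_gauss_density: "(\<integral>\<^sup>+ x. ennreal (gauss_density d v x) \<partial>lborel_dim d) = 1"
  by (subst nn_integral_eq_integral)
    (auto simp: integrable_gauss_density integral_gauss_density gauss_density_pos less_imp_le)

text \<open>Parallelogram law: \<open>x - v\<close> and \<open>x - (2 * u - v)\<close> are the sum
  and the difference of \<open>x - u\<close> and \<open>u - v\<close>. So p^2 / q is a multiple of
  another Gaussian density, and its integral, 1 plus the chi-squared divergence, is the exponential
  factor.\<close>

lemma gauss_density_sq_div:
  "(gauss_density d u x)\<^sup>2 =
     exp (\<Sum>i<d. (u i - v i)\<^sup>2) * gauss_density d v x * gauss_density d (\<lambda>i. 2 * u i - v i) x"
proof -
  have "- (\<Sum>i<d. (x i - u i)\<^sup>2) =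
      (\<Sum>i<d. (u i - v i)\<^sup>2) - (1 / 2) * (\<Sum>i<d. (x i - v i)\<^sup>2)
        - (1 / 2) * (\<Sum>i<d. (x i - (2 * u i - v i))\<^sup>2)"
    unfolding sum_distrib_left sum_subtractf[symmetric] sum_negf[symmetric]
    by (intro sum.cong refl) (simp add: power2_eq_square algebra_simps)
  then have "exp (- (\<Sum>i<d. (x i - u i)\<^sup>2)) = exp (\<Sum>i<d. (u i - v i)\<^sup>2)
       * exp (- (1 / 2) * (\<Sum>i<d. (x i - v i)\<^sup>2))
       * exp (- (1 / 2) * (\<Sum>i<d. (x i - (2 * u i - v i))\<^sup>2))"
    by (simp flip: exp_add)
  moreover have "(exp (- (1 / 2) * (\<Sum>i<d. (x i - u i)\<^sup>2)))\<^sup>2 = exp (- (\<Sum>i<d. (x i - u i)\<^sup>2))"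
    by (simp flip: exp_double)
  ultimately show ?thesis
    unfolding gauss_density_exp by (simp add: power_mult_distrib power2_eq_square)
qed

text \<open>Covers distant means, and later the classes with few expected samples.\<close>

lemma TV_gauss_le_1:
  "1 / 2 * (\<integral>x. \<bar>gauss_density d u x - gauss_density d v x\<bar> \<partial>lborel_dim d) \<le> 1"
proof -
  have "(\<integral>x. \<bar>gauss_density d u x - gauss_density d v x\<bar> \<partial>lborel_dim d)
      \<le> (\<integral>x. gauss_density d u x + gauss_density d v x \<partial>lborel_dim d)"
  proof (intro integral_mono)
    show "\<bar>gauss_density d u x - gauss_density d v x\<bar> \<le> gauss_density d u x + gauss_density d v x" for x
      using gauss_density_pos[of d u x] gauss_density_pos[of d v x] by linarith
  qed (auto simp: integrable_gauss_density)
  then show ?thesis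
    by (simp add: integrable_gauss_density integral_gauss_density)
qed

lemma exp_minus_one_le: "exp t - 1 \<le> 2 * t" if "0 \<le> t" "t \<le> 1" for t :: real
  using exp_bound[of t] that mult_left_le[of t t] by (simp add: power2_eq_square)

text \<open>The absolute difference is split by AM-GM,
  \<open>2 |p - q| \<le> c q + (p - q)\<^sup>2 / (c q)\<close> with \<open>c\<close> the distance of the means, so that the
  total variation is controlled by the chi-squared divergence \<open>exp (c\<^sup>2) - 1\<close>.\<close>

lemma TV_gauss_le:
  "1 / 2 * (\<integral>x. \<bar>gauss_density d u x - gauss_density d v x\<bar> \<partial>lborel_dim d)
     \<le> L2_set (\<lambda>i. u i - v i) {..<d}"
proof -
  define r where "r = L2_set (\<lambda>i. u i - v i) {..<d}"
  define p where "p = gauss_density d u"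
  define q where "q = gauss_density d v"
  define w where "w = gauss_density d (\<lambda>i. 2 * u i - v i)"
  have int: "integrable (lborel_dim d) p" "integrable (lborel_dim d) q" "integrable (lborel_dim d) w"
    by (simp_all add: p_def q_def w_def integrable_gauss_density)
  have one: "integral\<^sup>L (lborel_dim d) p = 1" "integral\<^sup>L (lborel_dim d) q = 1"
    "integral\<^sup>L (lborel_dim d) w = 1"
    by (simp_all add: p_def q_def w_def integral_gauss_density)
  have r2: "(\<Sum>i<d. (u i - v i)\<^sup>2) = r\<^sup>2"
    by (simp add: r_def L2_set_def sum_nonneg)
  have bound: "(\<integral>x. \<bar>p x - q x\<bar> \<partial>lborel_dim d) \<le> 1 / 2 * (c + (exp (r\<^sup>2) - 1) / c)" if "c > 0" for c
  proof -
    have "(\<integral>x. \<bar>p x - q x\<bar> \<partial>lborel_dim d)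
       \<le> (\<integral>x. 1 / 2 * (c * q x + (q x - 2 * p x + exp (r\<^sup>2) * w x) / c) \<partial>lborel_dim d)"
    proof (intro integral_mono)
      fix x
      have qx: "q x > 0" by (simp add: q_def gauss_density_pos)
      have sq: "(p x)\<^sup>2 = exp (r\<^sup>2) * q x * w x"
        using gauss_density_sq_div[of d u x v] by (simp add: p_def q_def w_def r2)
      have "0 \<le> (c * q x - \<bar>p x - q x\<bar>)\<^sup>2" by simp
      then have "2 * c * q x * \<bar>p x - q x\<bar> \<le> (c * q x)\<^sup>2 + (p x - q x)\<^sup>2"
        by (simp add: power2_diff)
      \<comment> \<open>By \<open>sq\<close>, (p - q)^2 is a multiple of q, so q cancels and the
        bound becomes linear in the three densities.\<close>
      also have "\<dots> = q x * (c\<^sup>2 * q x + (q x - 2 * p x + exp (r\<^sup>2) * w x))"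
        using sq by (simp add: power2_eq_square algebra_simps)
      finally have "q x * (2 * c * \<bar>p x - q x\<bar>)
          \<le> q x * (c\<^sup>2 * q x + (q x - 2 * p x + exp (r\<^sup>2) * w x))"
        by (simp add: mult_ac)
      then have "2 * c * \<bar>p x - q x\<bar> \<le> c\<^sup>2 * q x + (q x - 2 * p x + exp (r\<^sup>2) * w x)"
        using qx by simp
      then show "\<bar>p x - q x\<bar> \<le> 1 / 2 * (c * q x + (q x - 2 * p x + exp (r\<^sup>2) * w x) / c)"
        using that by (simp add: field_simps power2_eq_square)
    qed (use int in auto)
    also have "\<dots> = 1 / 2 * (c + (exp (r\<^sup>2) - 1) / c)"
      using int by (simp add: one)
    finally show ?thesis .
  qed
  have "r \<ge> 0" by (simp add: r_def)
  \<comment> \<open>The choice c = r needs r positive, and \<open>exp_minus_one_le\<close> needs r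
    at most 1; equal means and distances above 1 are handled directly.\<close>
  consider "r = 0" | "0 < r" "r \<le> 1" | "r > 1" using \<open>r \<ge> 0\<close> by linarith
  then have "1 / 2 * (\<integral>x. \<bar>p x - q x\<bar> \<partial>lborel_dim d) \<le> r"
  proof cases
    case 1
    have "u i = v i" if "i < d" for i
      using 1 r2 that by (simp add: sum_nonneg_eq_0_iff)
    then have "p = q"
      by (simp add: p_def q_def gauss_density_def fun_eq_iff)
    then show ?thesis using 1 by simp
  next
    case 2
    have "exp (r\<^sup>2) - 1 \<le> 2 * r\<^sup>2"
      using 2 by (intro exp_minus_one_le) (auto simp: power_le_one)
    then have "(exp (r\<^sup>2) - 1) / r \<le> 2 * r"
      using 2 by (simp add: field_simps power2_eq_square)
    then have "1 / 2 * (r + (exp (r\<^sup>2) - 1) / r) \<le> 3 / 2 * r" by argo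
    with bound[OF 2(1)] have "(\<integral>x. \<bar>p x - q x\<bar> \<partial>lborel_dim d) \<le> 3 / 2 * r" by (rule order_trans)
    then show ?thesis using 2 by simp
  next
    case 3
    then show ?thesis using TV_gauss_le_1[of d u v] by (simp add: p_def q_def)
  qed
  then show ?thesis by (simp add: p_def q_def r_def)
qed


section \<open>Chernoff bound for product measures; integration against the joint
  distribution\<close>

lemma ennreal_exp_prod:
  "finite A \<Longrightarrow> ennreal (exp (\<Sum>i\<in>A. f i)) = (\<Prod>i\<in>A. ennreal (exp (f i)))"
  by (simp add: exp_sum prod_ennreal)

text \<open>Markov's inequality for the exponential of the sum; independence makes its integral a
  product of \<open>n\<close> factors, each at most \<open>exp a\<close>. With nonnegative integrals
  throughout, no integrability has to be shown.\<close>

lemma chernoff_PiM: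
  fixes h :: "'a \<Rightarrow> real"
  assumes M: "prob_space M" and [measurable]: "h \<in> borel_measurable M"
    and mgf: "(\<integral>\<^sup>+ z. ennreal (exp (h z)) \<partial>M) \<le> ennreal (exp a)"
  shows "measure (Pi\<^sub>M {..<n} (\<lambda>_. M))
           {S \<in> space (Pi\<^sub>M {..<n} (\<lambda>_. M)). (\<Sum>i<n. h (S i)) \<ge> real n * a + t} \<le> exp (- t)"
proof -
  let ?P = "Pi\<^sub>M {..<n} (\<lambda>_. M)"
  interpret M: prob_space M by fact
  interpret product_sigma_finite "\<lambda>_::nat. M"
    by (simp add: product_sigma_finite_def M.sigma_finite_measure_axioms)
  interpret P: prob_space ?P using M by (intro prob_space_PiM)
  have eq: "{S \<in> space ?P. (\<Sum>i<n. h (S i)) \<ge> real n * a + t} =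
     {S \<in> space ?P. 1 \<le> ennreal (exp (- (real n * a + t))) * ennreal (exp (\<Sum>i<n. h (S i)))}"
    by (auto simp flip: ennreal_mult'' exp_add)
  have "emeasure ?P {S \<in> space ?P. (\<Sum>i<n. h (S i)) \<ge> real n * a + t}
     \<le> ennreal (exp (- (real n * a + t))) *
       (\<integral>\<^sup>+ S. ennreal (exp (\<Sum>i<n. h (S i))) * indicator (space ?P) S \<partial>?P)"
    unfolding eq by (intro nn_integral_Markov_inequality) measurable
  also have "(\<integral>\<^sup>+ S. ennreal (exp (\<Sum>i<n. h (S i))) * indicator (space ?P) S \<partial>?P) =
      (\<integral>\<^sup>+ S. (\<Prod>i<n. ennreal (exp (h (S i)))) \<partial>?P)"
    by (intro nn_integral_cong) (simp add: ennreal_exp_prod)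
  also have "\<dots> = (\<Prod>i<n. \<integral>\<^sup>+ z. ennreal (exp (h z)) \<partial>M)"
    by (intro product_nn_integral_prod) auto
  also have "\<dots> \<le> (\<Prod>i<n. ennreal (exp a))"
    by (intro prod_mono_ennreal mgf)
  also have "\<dots> = ennreal (exp (real n * a))"
    by (simp add: exp_of_nat_mult ennreal_power)
  also have "ennreal (exp (- (real n * a + t))) * ennreal (exp (real n * a)) = ennreal (exp (- t))"
    by (simp flip: ennreal_mult'' exp_add)
  finally show ?thesis
    by (simp add: P.emeasure_eq_measure mult_left_mono)
qed

lemma sigma_finite_lborel_dim: "sigma_finite_measure (lborel_dim d)"
proof -
  interpret product_sigma_finite "\<lambda>_::nat. lborel :: real measure"
    by (simp add: product_sigma_finite_def sigma_finite_lborel)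
  show ?thesis unfolding lborel_dim_def by (rule sigma_finite) simp
qed

lemma sets_joint_dist [measurable_cong]:
  "sets (joint_dist d K p pY) = sets (lborel_dim d \<Otimes>\<^sub>M count_space {1..K})"
  by (simp add: joint_dist_def)

lemma space_joint_dist: "space (joint_dist d K p pY) = space (lborel_dim d) \<times> {1..K}"
  by (simp add: joint_dist_def space_pair_measure)

text \<open>Tonelli, with the label as the outer variable. Measurability of \<open>p\<close> is
  asked for each fixed label; joint measurability follows because there are finitely many
  labels.\<close>

lemma nn_integral_joint_dist:
  assumes p: "\<And>k. k \<in> {1..K} \<Longrightarrow> (\<lambda>x. p x k) \<in> borel_measurable (lborel_dim d)"
    and nonneg: "\<And>x k. 0 \<le> p x k"
    and [measurable]: "f \<in> borel_measurable (lborel_dim d \<Otimes>\<^sub>M count_space {1..K})"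
  shows "(\<integral>\<^sup>+ z. f z \<partial>joint_dist d K p pY) =
     (\<Sum>k\<in>{1..K}. ennreal (pmf pY k) * (\<integral>\<^sup>+ x. ennreal (p x k) * f (x, k) \<partial>lborel_dim d))"
proof -
  interpret pair_sigma_finite "lborel_dim d" "count_space {1..K}"
    by (simp add: pair_sigma_finite_def sigma_finite_lborel_dim sigma_finite_measure_count_space_finite)
  have meas [measurable]: "(\<lambda>z. ennreal (p (fst z) (snd z) * pmf pY (snd z))) \<in> borel_measurable (lborel_dim d \<Otimes>\<^sub>M count_space {1..K})"
    by (rule measurable_compose_countable'[where f = "\<lambda>k z. ennreal (p (fst z) k * pmf pY k)" and g = snd and I = "{1..K}"])
      (use p in measurable)
  have "(\<integral>\<^sup>+ z. f z \<partial>joint_dist d K p pY) =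
     (\<integral>\<^sup>+ z. ennreal (p (fst z) (snd z) * pmf pY (snd z)) * f z \<partial>(lborel_dim d \<Otimes>\<^sub>M count_space {1..K}))"
    unfolding joint_dist_def case_prod_beta by (subst nn_integral_density) auto
  also have "\<dots> = (\<integral>\<^sup>+ k. \<integral>\<^sup>+ x. ennreal (p x k * pmf pY k) * f (x, k) \<partial>lborel_dim d \<partial>count_space {1..K})"
    by (subst nn_integral_snd[symmetric]) auto
  also have "\<dots> = (\<Sum>k\<in>{1..K}. \<integral>\<^sup>+ x. ennreal (p x k * pmf pY k) * f (x, k) \<partial>lborel_dim d)"
    by (simp add: nn_integral_count_space_finite)
  also have "\<dots> = (\<Sum>k\<in>{1..K}. ennreal (pmf pY k) * (\<integral>\<^sup>+ x. ennreal (p x k) * f (x, k) \<partial>lborel_dim d))"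
  proof (intro sum.cong refl)
    fix k assume k: "k \<in> {1..K}"
    have [measurable]: "(\<lambda>x. f (x, k)) \<in> borel_measurable (lborel_dim d)"
      using k by (intro measurable_compose[OF measurable_Pair2' assms(3)]) simp
    note p[OF k, measurable]
    show "(\<integral>\<^sup>+ x. ennreal (p x k * pmf pY k) * f (x, k) \<partial>lborel_dim d) =
        ennreal (pmf pY k) * (\<integral>\<^sup>+ x. ennreal (p x k) * f (x, k) \<partial>lborel_dim d)"
      by (subst nn_integral_cmult[symmetric]) (auto simp: ennreal_mult nonneg mult_ac)
  qed
  finally show ?thesis .
qed

lemma sum_pmf_ennreal:
  assumes "set_pmf pY \<subseteq> {1..K::nat}"
  shows "(\<Sum>k\<in>{1..K}. ennreal (pmf pY k)) = 1"
  using sum_pmf_eq_1[OF _ assms] by simp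

section \<open>Concentration of label counts and scores\<close>

definition label_count :: "nat \<Rightarrow> (nat \<Rightarrow> (nat \<Rightarrow> real) \<times> nat) \<Rightarrow> nat \<Rightarrow> real" where
  "label_count n S k = (\<Sum>i<n. of_bool (snd (S i) = k))"

text \<open>Coordinate \<open>j\<close> of the gradient of the Gaussian log-likelihood in the mean
  of class \<open>k\<close>, evaluated at \<open>m\<close>.\<close>

definition score ::
    "nat \<Rightarrow> (nat \<Rightarrow> (nat \<Rightarrow> real) \<times> nat) \<Rightarrow> (nat \<Rightarrow> real) \<Rightarrow> nat \<Rightarrow> nat \<Rightarrow> real" where
  "score n S m k j = (\<Sum>i<n. of_bool (snd (S i) = k) * (fst (S i) j - m j))"

lemma measurable_component: "j < d \<Longrightarrow> (\<lambda>x. x j) \<in> borel_measurable (lborel_dim d)"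
  unfolding lborel_dim_def by measurable

lemma measurable_label [measurable]:
  "(\<lambda>z. of_bool (snd z = k) :: real) \<in> borel_measurable (lborel_dim d \<Otimes>\<^sub>M count_space {1..K})"
  by measurable

lemma measurable_score:
  assumes "j < d"
  shows "(\<lambda>z. of_bool (snd z = k) * (l * (fst z j - m) - b) :: real)
    \<in> borel_measurable (lborel_dim d \<Otimes>\<^sub>M count_space {1..K})"
proof -
  note measurable_component[OF assms, measurable]
  show ?thesis by measurable
qed

text \<open>Completing the square: exponential tilting in coordinate \<open>j\<close> shifts that
  mean by \<open>l\<close>, and l^2 / 2 is exactly the normalising term. The tilted density
  integrates to 1, which yields \<open>mgf_score\<close>.\<close>

lemma gauss_density_tilt:
  assumes "j < d"
  shows "gauss_density d v x * exp (l * (x j - v j) - l\<^sup>2 / 2) = gauss_density d (v(j := v j + l)) x"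
proof -
  have "(\<Sum>i<d. (x i - v i)\<^sup>2) = (x j - v j)\<^sup>2 + (\<Sum>i\<in>{..<d} - {j}. (x i - v i)\<^sup>2)"
    using assms by (intro sum.remove) auto
  moreover have "(\<Sum>i<d. (x i - (v(j := v j + l)) i)\<^sup>2) =
      (x j - (v j + l))\<^sup>2 + (\<Sum>i\<in>{..<d} - {j}. (x i - v i)\<^sup>2)"
    using assms by (subst sum.remove[of _ j]) (auto intro!: sum.cong)
  ultimately have "- (1 / 2) * (\<Sum>i<d. (x i - v i)\<^sup>2) + (l * (x j - v j) - l\<^sup>2 / 2) =
      - (1 / 2) * (\<Sum>i<d. (x i - (v(j := v j + l)) i)\<^sup>2)"
    by (simp add: power2_eq_square field_simps)
  then show ?thesis
    unfolding gauss_density_exp by (simp flip: exp_add)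
qed

locale gauss_mixture =
  fixes d K :: nat and pY :: "nat pmf" and \<mu> :: "nat \<Rightarrow> nat \<Rightarrow> real"
  assumes supp: "set_pmf pY \<subseteq> {1..K}"
begin

abbreviation J where "J \<equiv> joint_dist d K (\<lambda>x k. gauss_density d (\<mu> k) x) pY"

lemma nn_integral_J:
  assumes "f \<in> borel_measurable (lborel_dim d \<Otimes>\<^sub>M count_space {1..K})"
  shows "(\<integral>\<^sup>+ z. f z \<partial>J) =
     (\<Sum>k\<in>{1..K}. ennreal (pmf pY k) * (\<integral>\<^sup>+ x. ennreal (gauss_density d (\<mu> k) x) * f (x, k) \<partial>lborel_dim d))"
  using assms by (intro nn_integral_joint_dist) (auto simp: gauss_density_pos less_imp_le)

lemma prob_space_J: "prob_space J"
proof
  have "emeasure J (space J) = (\<integral>\<^sup>+ z. 1 \<partial>J)" by simp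
  also have "\<dots> = 1"
    by (subst nn_integral_J) (auto simp: nn_integral_gauss_density sum_pmf_ennreal[OF supp])
  finally show "emeasure J (space J) = 1" .
qed

text \<open>The quadratic compensation by the label indicator makes the moment generating function
  exactly 1, without conditioning on the labels.\<close>

lemma mgf_score:
  assumes "j < d"
  shows "(\<integral>\<^sup>+ z. ennreal (exp (of_bool (snd z = k) * (l * (fst z j - \<mu> k j) - l\<^sup>2 / 2))) \<partial>J) = 1"
proof -
  note measurable_score[OF assms, measurable]
  have "(\<integral>\<^sup>+ x. ennreal (gauss_density d (\<mu> k') x) *
      ennreal (exp (of_bool (k' = k) * (l * (x j - \<mu> k j) - l\<^sup>2 / 2))) \<partial>lborel_dim d) = 1" for k'
  proof (cases "k' = k")
    case True
    then show ?thesis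
      using nn_integral_gauss_density
      by (simp add: gauss_density_tilt[OF assms] gauss_density_pos less_imp_le flip: ennreal_mult)
  qed (simp add: nn_integral_gauss_density)
  moreover have "(\<lambda>z. exp (of_bool (snd z = k) * (l * (fst z j - \<mu> k j) - l\<^sup>2 / 2)))
      \<in> borel_measurable (lborel_dim d \<Otimes>\<^sub>M count_space {1..K})"
    by measurable
  ultimately show ?thesis
    by (subst nn_integral_J) (auto simp: sum_pmf_ennreal[OF supp])
qed

text \<open>With p the probability of label \<open>k\<close>, the integral is 1 - p (1 - 1/e); then
  1/e <= 1/2 and 1 - x <= exp (- x). Through \<open>chernoff_PiM\<close> this bounds the label count
  from below.\<close>

lemma mgf_label:
  assumes k: "k \<in> {1..K}"
  shows "(\<integral>\<^sup>+ z. ennreal (exp (- of_bool (snd z = k))) \<partial>J) \<le> ennreal (exp (- pmf pY k / 2))"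
proof -
  have e: "exp (- 1 :: real) \<le> 1 / 2"
    using exp_ge_add_one_self[of 1] by (simp add: exp_minus field_simps)
  have "(\<integral>\<^sup>+ x. ennreal (gauss_density d (\<mu> k') x) *
      ennreal (exp (- of_bool (k' = k))) \<partial>lborel_dim d) = ennreal (exp (- of_bool (k' = k)))" for k'
    by (subst nn_integral_multc) (auto simp: nn_integral_gauss_density)
  then have "(\<integral>\<^sup>+ z. ennreal (exp (- of_bool (snd z = k))) \<partial>J) =
      (\<Sum>k'\<in>{1..K}. ennreal (pmf pY k') * ennreal (exp (- of_bool (k' = k))))"
    by (subst nn_integral_J) auto
  also have "\<dots> = ennreal (\<Sum>k'\<in>{1..K}. pmf pY k' * exp (- of_bool (k' = k)))"
    by (simp flip: ennreal_mult)
  also have "(\<Sum>k'\<in>{1..K}. pmf pY k' * exp (- of_bool (k' = k) :: real)) =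
      (\<Sum>k'\<in>{1..K}. pmf pY k' + (if k' = k then pmf pY k' * (exp (- 1) - 1) else 0))"
    by (intro sum.cong refl) (auto simp: algebra_simps)
  also have "\<dots> = 1 + pmf pY k * (exp (- 1) - 1)"
    using k sum_pmf_eq_1[OF _ supp] by (simp add: sum.distrib)
  also have "\<dots> \<le> 1 + pmf pY k * (- 1 / 2)"
    using e by (intro add_left_mono mult_left_mono) auto
  also have "\<dots> \<le> exp (- pmf pY k / 2)"
    using exp_ge_add_one_self[of "- pmf pY k / 2"] by simp
  finally show ?thesis by (simp add: ennreal_leI)
qed

end

context gauss_mixture
begin

text \<open>A union bound over one event per label and two per pair of label and coordinate, each of
  probability at most \<open>exp (- t)\<close>. The tilts \<open>l\<close> are fixed before
  sampling, while the random label count stays in the bound on the score.\<close>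

lemma concentration_event:
  fixes n :: nat and t :: real and l :: "nat \<Rightarrow> real"
  defines "P \<equiv> Pi\<^sub>M {..<n} (\<lambda>_. J)"
  shows "\<exists>A\<in>sets P. measure P A \<ge> 1 - real (K + 2 * K * d) * exp (- t) \<and>
    (\<forall>S\<in>A. \<forall>k\<in>{1..K}. label_count n S k \<ge> real n * pmf pY k / 2 - t \<and>
      (\<forall>j<d. \<bar>l k * score n S (\<mu> k) k j\<bar> \<le> (l k)\<^sup>2 * label_count n S k / 2 + t))"
proof -
  \<comment> \<open>\<open>Inl k\<close> indexes the lower tail of the label count,
    \<open>Inr (k, j, s)\<close> the upper tail of the score multiplied by the sign
    \<open>s\<close>.\<close>
  define I where "I = {1..K} <+> ({1..K} \<times> {..<d} \<times> {- 1, 1 :: real})"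
  define h :: "nat + nat \<times> nat \<times> real \<Rightarrow> (nat \<Rightarrow> real) \<times> nat \<Rightarrow> real" where
    "h = case_sum (\<lambda>k z. - of_bool (snd z = k))
      (\<lambda>(k, j, s) z. of_bool (snd z = k) * ((s * l k) * (fst z j - \<mu> k j) - (s * l k)\<^sup>2 / 2))"
  \<comment> \<open>Logarithms of the bounds in \<open>mgf_label\<close> and
    \<open>mgf_score\<close>.\<close>
  define a :: "nat + nat \<times> nat \<times> real \<Rightarrow> real" where
    "a = case_sum (\<lambda>k. - pmf pY k / 2) (\<lambda>_. 0)"
  define bad where "bad i = {S \<in> space P. (\<Sum>m<n. h i (S m)) \<ge> real n * a i + t}" for i
  define A where "A = space P - (\<Union>i\<in>I. bad i)"
  interpret P: prob_space P
    unfolding P_def by (intro prob_space_PiM prob_space_J)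
  have I: "finite I" "card I = K + 2 * K * d"
    by (simp_all add: I_def card_Plus card_cartesian_product)
  have meas: "h i \<in> borel_measurable J" if "i \<in> I" for i
  proof (cases i)
    case (Inl k)
    have "(\<lambda>z. - of_bool (snd z = k) :: real) \<in> borel_measurable (lborel_dim d \<Otimes>\<^sub>M count_space {1..K})"
      by measurable
    then show ?thesis by (simp add: h_def Inl cong: measurable_cong_sets)
  next
    case (Inr u)
    obtain k j s where u: "u = (k, j, s)" by (cases u)
    have "j < d" using that by (auto simp: I_def Inr u)
    from measurable_score[OF this, of k "s * l k" "\<mu> k j" "(s * l k)\<^sup>2 / 2"]
    show ?thesis by (simp add: h_def Inr u cong: measurable_cong_sets)
  qed
  have mgf: "(\<integral>\<^sup>+ z. ennreal (exp (h i z)) \<partial>J) \<le> ennreal (exp (a i))" if "i \<in> I" for i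
  proof (cases i)
    case (Inl k)
    then show ?thesis using that mgf_label[of k] by (auto simp: I_def h_def a_def)
  next
    case (Inr u)
    obtain k j s where u: "u = (k, j, s)" by (cases u)
    have "j < d" using that by (auto simp: I_def Inr u)
    from mgf_score[OF this, of k "s * l k"] show ?thesis by (simp add: h_def a_def Inr u)
  qed
  have bad_sets: "bad i \<in> sets P" if "i \<in> I" for i
  proof -
    note meas[OF that, measurable]
    show ?thesis unfolding bad_def P_def by measurable
  qed
  have "measure P (\<Union>i\<in>I. bad i) \<le> (\<Sum>i\<in>I. measure P (bad i))"
    using I bad_sets by (intro measure_UNION_le) auto
  also have "\<dots> \<le> (\<Sum>i\<in>I. exp (- t))"
    unfolding bad_def P_def by (intro sum_mono chernoff_PiM prob_space_J meas mgf)
  finally have "measure P (\<Union>i\<in>I. bad i) \<le> real (K + 2 * K * d) * exp (- t)"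
    by (simp add: I)
  moreover have U: "(\<Union>i\<in>I. bad i) \<in> sets P"
    using I bad_sets by (intro sets.finite_UN) auto
  moreover have "measure P A = 1 - measure P (\<Union>i\<in>I. bad i)"
    unfolding A_def using U by (rule P.prob_compl)
  ultimately have "A \<in> sets P" "measure P A \<ge> 1 - real (K + 2 * K * d) * exp (- t)"
    by (auto simp: A_def)
  moreover have "label_count n S k \<ge> real n * pmf pY k / 2 - t \<and>
      (\<forall>j<d. \<bar>l k * score n S (\<mu> k) k j\<bar> \<le> (l k)\<^sup>2 * label_count n S k / 2 + t)"
    if "S \<in> A" "k \<in> {1..K}" for S k
  proof -
    have good: "(\<Sum>m<n. h i (S m)) < real n * a i + t" if "i \<in> I" for i
      using \<open>S \<in> A\<close> that by (auto simp: A_def bad_def)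
    have "(\<Sum>m<n. h (Inl k) (S m)) = - label_count n S k"
      by (simp add: h_def label_count_def sum_negf)
    moreover have "Inl k \<in> I" using that by (auto simp: I_def)
    ultimately have 1: "label_count n S k \<ge> real n * pmf pY k / 2 - t"
      using good[of "Inl k"] by (simp add: a_def)
    have 2: "\<bar>l k * score n S (\<mu> k) k j\<bar> \<le> (l k)\<^sup>2 * label_count n S k / 2 + t" if "j < d" for j
    proof -
      \<comment> \<open>Since s^2 = 1 for both signs, they share one compensator and together bound
        the absolute value.\<close>
      have "(\<Sum>m<n. h (Inr (k, j, s)) (S m)) =
          s * (l k * score n S (\<mu> k) k j) - s\<^sup>2 * ((l k)\<^sup>2 * label_count n S k / 2)" for s
        unfolding h_def score_def label_count_def sum_distrib_left sum_divide_distrib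
          sum_subtractf[symmetric]
        by (auto intro!: sum.cong simp: power_mult_distrib algebra_simps)
      moreover have "Inr (k, j, 1) \<in> I" "Inr (k, j, - 1) \<in> I"
        using that \<open>k \<in> {1..K}\<close> by (auto simp: I_def)
      ultimately show ?thesis
        using good[of "Inr (k, j, 1)"] good[of "Inr (k, j, - 1)"] by (simp add: a_def)
    qed
    show ?thesis using 1 2 by blast
  qed
  ultimately show ?thesis by blast
qed

end

section \<open>Maximum likelihood as least squares and the basic inequality\<close>

lemma single_class_member_at:
  assumes "y \<in> {1..K}"
  shows "(\<Prod>k\<in>{1..K}. gauss_cond d d1 (\<phi> k) (\<psi> k) x k ^ of_bool (y = k)) =
    gauss_density d (vec_concat d1 (\<phi> y) (\<psi> y)) x"
proof -
  have "(\<Prod>k\<in>{1..K}. gauss_cond d d1 (\<phi> k) (\<psi> k) x k ^ of_bool (y = k)) =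
      (\<Prod>k\<in>{1..K}. if y = k then gauss_cond d d1 (\<phi> k) (\<psi> k) x k else 1)"
    by (intro prod.cong) auto
  \<comment> \<open>Only the factor with k = y survives; it occurs because y lies in {1..K}, and
    otherwise the product would be 1.\<close>
  then show ?thesis using assms by (simp add: gauss_cond_eq)
qed

text \<open>The normalising constant does not depend on the means \<open>w\<close>, so comparing
  likelihoods amounts to comparing sums of squares.\<close>

lemma likelihood_gauss:
  assumes "\<And>i. i < n \<Longrightarrow> p (fst (S i)) (snd (S i)) = gauss_density d (w (snd (S i))) (fst (S i))"
  shows "likelihood n S p = ((2 * pi) powr (- real d / 2)) ^ n *
    exp (- (1 / 2) * (\<Sum>i<n. \<Sum>j<d. (fst (S i) j - w (snd (S i)) j)\<^sup>2))"
proof -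
  have "likelihood n S p = (\<Prod>i<n. gauss_density d (w (snd (S i))) (fst (S i)))"
    unfolding likelihood_def using assms by (intro prod.cong) auto
  then show ?thesis
    by (simp add: gauss_density_exp prod.distrib sum_distrib_left exp_sum)
qed

text \<open>Parameters of different labels vary independently in \<open>single_class\<close>, so
  replacing those of class \<open>k\<close> alone by the true ones stays in the class. In the
  comparison only samples labelled \<open>k\<close> contribute, and Cauchy-Schwarz finishes.\<close>

lemma MLE_basic_inequality:
  assumes mle: "is_MLE n S (single_class d d1 K B) p"
    and labels: "\<And>i. i < n \<Longrightarrow> snd (S i) \<in> {1..K}"
    and truth: "\<And>k. k \<in> {1..K} \<Longrightarrow> \<phi>s k \<in> cube d1 B" "\<And>k. k \<in> {1..K} \<Longrightarrow> \<psi>s k \<in> cube (d - d1) B"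
  defines "\<mu> \<equiv> \<lambda>k. vec_concat d1 (\<phi>s k) (\<psi>s k)"
  obtains w where "\<And>k x. k \<in> {1..K} \<Longrightarrow> p x k = gauss_density d (w k) x"
    "\<And>k. k \<in> {1..K} \<Longrightarrow> label_count n S k * L2_set (\<lambda>j. w k j - \<mu> k j) {..<d}
       \<le> 2 * L2_set (score n S (\<mu> k) k) {..<d}"
proof -
  define Pr where "Pr \<phi> \<psi> = (\<lambda>x y. \<Prod>k\<in>{1..K}. gauss_cond d d1 (\<phi> k) (\<psi> k) x k ^ of_bool (y = k))"
    for \<phi> \<psi> :: "nat \<Rightarrow> nat \<Rightarrow> real"
  have Pr_at: "Pr \<phi> \<psi> x k = gauss_density d (vec_concat d1 (\<phi> k) (\<psi> k)) x" if "k \<in> {1..K}" for \<phi> \<psi> x k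
    unfolding Pr_def using that by (rule single_class_member_at)
  have class_eq: "single_class d d1 K B = {Pr \<phi> \<psi> | \<phi> \<psi>.
      (\<forall>k\<in>{1..K}. \<phi> k \<in> cube d1 B) \<and> (\<forall>k\<in>{1..K}. \<psi> k \<in> cube (d - d1) B)}"
    by (simp add: single_class_def Pr_def)
  have p: "p \<in> single_class d d1 K B"
    and max: "\<And>q. q \<in> single_class d d1 K B \<Longrightarrow> likelihood n S q \<le> likelihood n S p"
    using mle by (auto simp: is_MLE_def is_arg_max_def not_less)
  obtain \<phi> \<psi> where \<phi>\<psi>: "p = Pr \<phi> \<psi>" "\<forall>k\<in>{1..K}. \<phi> k \<in> cube d1 B"
      "\<forall>k\<in>{1..K}. \<psi> k \<in> cube (d - d1) B"
    using p unfolding class_eq by blast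
  define w where "w k = vec_concat d1 (\<phi> k) (\<psi> k)" for k
  have p_at: "p x k = gauss_density d (w k) x" if "k \<in> {1..K}" for x k
    using Pr_at[OF that] by (simp add: \<phi>\<psi> w_def)
  have "label_count n S k * L2_set (\<lambda>j. w k j - \<mu> k j) {..<d}
       \<le> 2 * L2_set (score n S (\<mu> k) k) {..<d}" if k: "k \<in> {1..K}" for k
  proof -
    define r where "r = L2_set (\<lambda>j. w k j - \<mu> k j) {..<d}"
    define N where "N = label_count n S k"
    define T where "T = score n S (\<mu> k) k"
    define q where "q = Pr (\<phi>(k := \<phi>s k)) (\<psi>(k := \<psi>s k))"
    have "q \<in> single_class d d1 K B"
      unfolding class_eq q_def using \<phi>\<psi> truth
      by (intro CollectI exI[of _ "\<phi>(k := \<phi>s k)"] exI[of _ "\<psi>(k := \<psi>s k)"] conjI refl) auto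
    then have "likelihood n S q \<le> likelihood n S p" by (rule max)
    moreover have "likelihood n S p = ((2 * pi) powr (- real d / 2)) ^ n *
        exp (- (1 / 2) * (\<Sum>i<n. \<Sum>j<d. (fst (S i) j - w (snd (S i)) j)\<^sup>2))"
      using labels by (intro likelihood_gauss p_at)
    moreover have "likelihood n S q = ((2 * pi) powr (- real d / 2)) ^ n *
        exp (- (1 / 2) * (\<Sum>i<n. \<Sum>j<d. (fst (S i) j - (w(k := \<mu> k)) (snd (S i)) j)\<^sup>2))"
      using labels by (intro likelihood_gauss) (simp add: q_def Pr_at w_def \<mu>_def)
    ultimately have "(\<Sum>i<n. \<Sum>j<d. (fst (S i) j - w (snd (S i)) j)\<^sup>2) \<le>
        (\<Sum>i<n. \<Sum>j<d. (fst (S i) j - (w(k := \<mu> k)) (snd (S i)) j)\<^sup>2)"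
      by simp
    then have "0 \<le> (\<Sum>i<n. \<Sum>j<d. (fst (S i) j - (w(k := \<mu> k)) (snd (S i)) j)\<^sup>2
        - (fst (S i) j - w (snd (S i)) j)\<^sup>2)"
      by (simp add: sum_subtractf)
    \<comment> \<open>With a = x - \<mu> and b = w - \<mu> this is a^2 - (a - b)^2 = 2 a b - b^2;
      samples with other labels cancel.\<close>
    also have "\<dots> = (\<Sum>i<n. \<Sum>j<d. of_bool (snd (S i) = k) * (fst (S i) j - \<mu> k j) * (2 * (w k j - \<mu> k j))
        - of_bool (snd (S i) = k) * (w k j - \<mu> k j)\<^sup>2)"
      by (intro sum.cong refl) (auto simp: power2_eq_square algebra_simps)
    also have "\<dots> = (\<Sum>j<d. T j * (2 * (w k j - \<mu> k j)) - N * (w k j - \<mu> k j)\<^sup>2)"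
      unfolding T_def N_def score_def label_count_def sum_distrib_right sum_subtractf[symmetric]
      by (rule sum.swap)
    also have "\<dots> = 2 * (\<Sum>j<d. T j * (w k j - \<mu> k j)) - N * r\<^sup>2"
      by (simp add: sum_subtractf r_def L2_set_def sum_nonneg sum_distrib_left mult_ac)
    finally have "N * r\<^sup>2 \<le> 2 * (\<Sum>j<d. T j * (w k j - \<mu> k j))" by simp
    also have "(\<Sum>j<d. T j * (w k j - \<mu> k j)) \<le> (\<Sum>j<d. \<bar>T j\<bar> * \<bar>w k j - \<mu> k j\<bar>)"
      by (intro sum_mono) (simp flip: abs_mult)
    also have "\<dots> \<le> L2_set T {..<d} * r"
      unfolding r_def by (rule L2_set_mult_ineq)
    finally have "(N * r) * r \<le> (2 * L2_set T {..<d}) * r"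
      by (simp add: power2_eq_square mult_ac)
    moreover have "r \<ge> 0" by (simp add: r_def)
    \<comment> \<open>If r = 0 the left side vanishes; otherwise one factor r cancels.\<close>
    ultimately have "N * r \<le> 2 * L2_set T {..<d}"
      by (cases "r = 0") (auto simp: mult_le_cancel_right)
    then show ?thesis by (simp add: N_def r_def T_def)
  qed
  with p_at show thesis by (rule that)
qed

section \<open>Error in one class, averaging over the classes, and the rate\<close>

lemma deviation_bound:
  fixes q t l N r :: real and T :: "nat \<Rightarrow> real"
  assumes "t > 0" "q \<ge> 4 * t" and l: "l = sqrt (t / q)"
    and N: "N \<ge> q / 2 - t" and T: "\<And>j. j < d \<Longrightarrow> \<bar>l * T j\<bar> \<le> l\<^sup>2 * N / 2 + t"
    and r: "N * r \<le> 2 * L2_set T {..<d}"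
  shows "r \<le> 9 * sqrt (real d * t / q)"
proof -
  have pos: "q > 0" "l > 0" using assms by auto
  \<comment> \<open>\<open>q\<close> stands for the expected number of samples in the class; t <= q
    / 4 turns q / 2 - t into at least q / 4.\<close>
  have N4: "N \<ge> q / 4" "N > 0" using assms pos by auto
  have t: "t = l\<^sup>2 * q" using l pos assms by simp
  have "l * L2_set T {..<d} = L2_set (\<lambda>j. l * T j) {..<d}"
    using pos by (intro L2_set_right_distrib) simp
  also have "\<dots> = L2_set (\<lambda>j. \<bar>l * T j\<bar>) {..<d}"
    by (simp add: L2_set_def)
  also have "\<dots> \<le> L2_set (\<lambda>j. l\<^sup>2 * N / 2 + t) {..<d}"
    using T by (intro L2_set_mono) auto
  also have "\<dots> = sqrt (real d) * (l\<^sup>2 * N / 2 + t)"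
    using N4 assms by (simp add: L2_set_constant)
  \<comment> \<open>By t = l^2 q and q <= 4 N the bracket is at most (1/2 + 4) l^2 N; doubling gives
    the constant 9.\<close>
  also have "\<dots> \<le> sqrt (real d) * (l\<^sup>2 * N / 2 + l\<^sup>2 * (4 * N))"
    unfolding t using N4 by (intro mult_left_mono add_left_mono) auto
  finally have "l * (2 * L2_set T {..<d}) \<le> (l * N) * (9 * (sqrt (real d) * l))"
    by (simp add: power2_eq_square algebra_simps)
  moreover have "l * (N * r) \<le> l * (2 * L2_set T {..<d})"
    using r pos by simp
  ultimately have "(l * N) * r \<le> (l * N) * (9 * (sqrt (real d) * l))"
    by (simp add: mult_ac)
  then have "r \<le> 9 * (sqrt (real d) * l)"
    using pos N4 by simp
  then show ?thesis by (simp add: l flip: real_sqrt_mult)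
qed

lemma sum_sqrt_pmf_le:
  assumes "set_pmf pY \<subseteq> {1..K::nat}"
  shows "(\<Sum>k\<in>{1..K}. sqrt (pmf pY k)) \<le> sqrt (real K)"
proof -
  have "(\<Sum>k\<in>{1..K}. \<bar>sqrt (pmf pY k)\<bar> * \<bar>1\<bar>) \<le>
      L2_set (\<lambda>k. sqrt (pmf pY k)) {1..K} * L2_set (\<lambda>_. 1) {1..K}"
    by (rule L2_set_mult_ineq)
  then show ?thesis
    using sum_pmf_eq_1[OF _ assms] by (simp add: L2_set_def)
qed

text \<open>Each of 3, \<open>K\<close>, \<open>d\<close> and 1 / \<delta> is at most the argument M
  of the logarithm on the right, so their product is at most M^4. Here n >= 1 gives 3 <= M.\<close>

lemma ln_rate_le:
  fixes K d n :: nat and B \<delta> :: real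
  assumes "d \<ge> 1" "K \<ge> 1" "n \<ge> 1" "B > 0" "0 < \<delta>"
  shows "ln (3 * real K * real d / \<delta>) \<le> 4 * ln (2 + real n + real K + real d + B + 1 / \<delta>)"
proof -
  define M where "M = 2 + real n + real K + real d + B + 1 / \<delta>"
  have "1 / \<delta> > 0" using assms by simp
  then have *: "3 \<le> M" "real K \<le> M" "real d \<le> M" "1 / \<delta> \<le> M"
    using assms unfolding M_def by linarith+
  have "3 * real K * real d / \<delta> = 3 * real K * real d * (1 / \<delta>)" by simp
  also have "\<dots> \<le> M * M * M * M"
    using * assms by (intro mult_mono) auto
  finally have "3 * real K * real d / \<delta> \<le> M ^ 4"
    by (simp add: power4_eq_xxxx)
  moreover have "0 < 3 * real K * real d / \<delta>" using assms by simp
  ultimately have "ln (3 * real K * real d / \<delta>) \<le> ln (M ^ 4)"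
    by (intro ln_mono) auto
  then show ?thesis using * by (simp add: ln_realpow M_def)
qed

theorem theoremB2:
  "\<exists>C c :: real. C > 0 \<and> c > 0 \<and>
     (\<forall>(d :: nat) (d1 :: nat) (K :: nat) (n :: nat) (B :: real) (\<delta> :: real) (pY :: nat pmf)
       (\<phi>s :: nat \<Rightarrow> nat \<Rightarrow> real) (\<psi>s :: nat \<Rightarrow> real) (pstar :: cond_density)
       (phat :: (nat \<Rightarrow> (nat \<Rightarrow> real) \<times> nat) \<Rightarrow> cond_density).
        d \<ge> 1 \<longrightarrow> d1 \<le> d \<longrightarrow> K \<ge> 1 \<longrightarrow> n \<ge> 1 \<longrightarrow> B > 0 \<longrightarrow> 0 < \<delta> \<longrightarrow> \<delta> \<le> 1 / 2 \<longrightarrow>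
        set_pmf pY \<subseteq> {1..K} \<longrightarrow>
        (\<forall>k\<in>{1..K}. \<phi>s k \<in> cube d1 B) \<longrightarrow>
        \<psi>s \<in> cube (d - d1) B \<longrightarrow>
        pstar = (\<lambda>x k. gauss_cond d d1 (\<phi>s k) \<psi>s x k) \<longrightarrow>
        (\<forall>S\<in>space (sample_dist n d K pstar pY). is_MLE n S (single_class d d1 K B) (phat S)) \<longrightarrow>
        (\<exists>A\<in>sets (sample_dist n d K pstar pY).
           measure (sample_dist n d K pstar pY) A \<ge> 1 - \<delta> \<and>
           (\<forall>S\<in>A. avg_TV d pY (phat S) pstar
              \<le> C * sqrt (real K * real d / real n) *
                 ln (2 + real n + real K + real d + B + 1 / \<delta>) powr c)))"
\<comment> \<open>18 = 9 * 2: the 9 comes from \<open>deviation_bound\<close>, the 2 is the root of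
  the factor 4 in \<open>ln_rate_le\<close>. The exponent is 1 / 2 because the logarithm enters
  under the root.\<close>
proof (rule exI[of _ 18], rule exI[of _ "1 / 2"], intro conjI allI impI)
  fix d d1 K n :: nat and B \<delta> :: real and pY :: "nat pmf" and \<phi>s :: "nat \<Rightarrow> nat \<Rightarrow> real"
    and \<psi>s :: "nat \<Rightarrow> real" and pstar :: cond_density
    and phat :: "(nat \<Rightarrow> (nat \<Rightarrow> real) \<times> nat) \<Rightarrow> cond_density"
  assume A: "d \<ge> 1" "d1 \<le> d" "K \<ge> 1" "n \<ge> 1" "B > 0" "0 < \<delta>" "\<delta> \<le> 1 / 2"
    and supp: "set_pmf pY \<subseteq> {1..K}"
    and \<phi>s: "\<forall>k\<in>{1..K}. \<phi>s k \<in> cube d1 B" and \<psi>s: "\<psi>s \<in> cube (d - d1) B"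
    and pstar: "pstar = (\<lambda>x k. gauss_cond d d1 (\<phi>s k) \<psi>s x k)"
    and mle: "\<forall>S\<in>space (sample_dist n d K pstar pY). is_MLE n S (single_class d d1 K B) (phat S)"
  define \<mu> where "\<mu> k = vec_concat d1 (\<phi>s k) \<psi>s" for k
  \<comment> \<open>Makes exp (- t) equal to \<delta> / (3 K d), while the union bound runs over K +
    2 K d <= 3 K d events.\<close>
  define t where "t = ln (3 * real K * real d / \<delta>)"
  define M where "M = 2 + real n + real K + real d + B + 1 / \<delta>"
  interpret gauss_mixture d K pY \<mu> by standard (rule supp)
  have pstar_eq: "pstar = (\<lambda>x k. gauss_density d (\<mu> k) x)"
    by (simp add: pstar gauss_cond_eq \<mu>_def)
  have Kd: "real K * real d \<ge> 1"
    using mult_mono[of 1 "real K" 1 "real d"] A by simp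
  have "1 < 3 * real K * real d / \<delta>"
    using A Kd by (simp add: field_simps)
  then have t: "t > 0" by (simp add: t_def)
  have "exp (- t) = \<delta> / (3 * real K * real d)"
    using A by (simp add: t_def exp_minus)
  moreover have "real (K + 2 * K * d) \<le> 3 * real K * real d"
    using A mult_left_mono[of 1 "real d" "real K"] by (simp add: algebra_simps)
  ultimately have "real (K + 2 * K * d) * exp (- t) \<le> (3 * real K * real d) * (\<delta> / (3 * real K * real d))"
    using A by (intro mult_mono) auto
  then have prob: "real (K + 2 * K * d) * exp (- t) \<le> \<delta>"
    using A by simp
  \<comment> \<open>Where p = \<open>pmf pY k\<close> is positive, t = l^2 n p, which balances the
    terms of the score bound. If p = 0, division by zero gives \<open>l k = 0\<close>; such a class
    has weight 0 in the average.\<close>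
  define l where "l k = sqrt (t / (real n * pmf pY k))" for k
  obtain E where E: "E \<in> sets (sample_dist n d K pstar pY)"
      "measure (sample_dist n d K pstar pY) E \<ge> 1 - real (K + 2 * K * d) * exp (- t)"
    and conc: "\<And>S k. S \<in> E \<Longrightarrow> k \<in> {1..K} \<Longrightarrow> label_count n S k \<ge> real n * pmf pY k / 2 - t"
      "\<And>S k j. S \<in> E \<Longrightarrow> k \<in> {1..K} \<Longrightarrow> j < d \<Longrightarrow>
        \<bar>l k * score n S (\<mu> k) k j\<bar> \<le> (l k)\<^sup>2 * label_count n S k / 2 + t"
    using concentration_event[of n t l] unfolding sample_dist_def pstar_eq by blast
  have "avg_TV d pY (phat S) pstar \<le> 18 * sqrt (real K * real d / real n) * ln M powr (1 / 2)"
    if S: "S \<in> E" for S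
  proof -
    \<comment> \<open>Membership in the sample space gives both maximality of \<open>phat S\<close>
      and labels in {1..K}.\<close>
    have space: "S \<in> space (sample_dist n d K pstar pY)"
      using E(1) S sets.sets_into_space by blast
    then have labels: "snd (S i) \<in> {1..K}" if "i < n" for i
      using that by (auto simp: sample_dist_def space_PiM space_joint_dist PiE_def Pi_def mem_Times_iff)
    obtain w where w: "\<And>k x. k \<in> {1..K} \<Longrightarrow> phat S x k = gauss_density d (w k) x"
      "\<And>k. k \<in> {1..K} \<Longrightarrow> label_count n S k * L2_set (\<lambda>j. w k j - \<mu> k j) {..<d}
         \<le> 2 * L2_set (score n S (\<mu> k) k) {..<d}"
      using MLE_basic_inequality[of n S d d1 K B "phat S" \<phi>s "\<lambda>_. \<psi>s"] mle space labels \<phi>s \<psi>s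
      unfolding \<mu>_def by blast
    define TV where "TV k = 1 / 2 * (\<integral>x. \<bar>phat S x k - pstar x k\<bar> \<partial>lborel_dim d)" for k
    have TV: "TV k \<le> 9 * sqrt (real d * t / (real n * pmf pY k))"
      if k: "k \<in> {1..K}" and p: "pmf pY k > 0" for k
    proof (cases "real n * pmf pY k \<ge> 4 * t")
      case True
      have "TV k \<le> L2_set (\<lambda>j. w k j - \<mu> k j) {..<d}"
        using TV_gauss_le[of d "w k" "\<mu> k"] by (simp add: TV_def w(1)[OF k] pstar_eq)
      also have "\<dots> \<le> 9 * sqrt (real d * t / (real n * pmf pY k))"
        by (rule deviation_bound[OF t True l_def conc(1)[OF S k] conc(2)[OF S k] w(2)[OF k]])
      finally show ?thesis .
    next
      case False
      have "TV k \<le> 1"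
        using TV_gauss_le_1[of d "w k" "\<mu> k"] by (simp add: TV_def w(1)[OF k] pstar_eq)
      \<comment> \<open>The expected count is below 4 t <= 4 d t, so the ratio under the root is at
        least 1 / 4 and the right side at least 9 / 2.\<close>
      also have "real n * pmf pY k \<le> 4 * (real d * t)"
        using False A t mult_right_mono[of 1 "real d" t] by linarith
      then have "(1 / 2)\<^sup>2 \<le> real d * t / (real n * pmf pY k)"
        using p A by (simp add: field_simps power2_eq_square)
      then have "1 / 2 \<le> sqrt (real d * t / (real n * pmf pY k))"
        by (rule real_le_rsqrt)
      then have "1 \<le> 9 * sqrt (real d * t / (real n * pmf pY k))" by simp
      finally show ?thesis .
    qed
    \<comment> \<open>Weighting by p turns 1 / sqrt p into sqrt p and extends the bound to classes
      of probability 0.\<close>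
    have weighted: "pmf pY k * TV k \<le> 9 * sqrt (real d * t / real n) * sqrt (pmf pY k)"
      if k: "k \<in> {1..K}" for k
    proof (cases "pmf pY k = 0")
      case False
      then have p: "pmf pY k > 0" by (simp add: pmf_nonneg less_le)
      have "pmf pY k * TV k \<le> pmf pY k * (9 * sqrt (real d * t / (real n * pmf pY k)))"
        using TV[OF k p] by (intro mult_left_mono) auto
      also have "\<dots> = 9 * sqrt (real d * t / real n) * (pmf pY k / sqrt (pmf pY k))"
        by (simp add: real_sqrt_divide real_sqrt_mult)
      finally show ?thesis using p by (simp add: real_div_sqrt)
    qed simp
    have "avg_TV d pY (phat S) pstar = (\<Sum>k\<in>{1..K}. pmf pY k * TV k)"
      unfolding avg_TV_def TV_def using supp by (subst integral_measure_pmf[of "{1..K}"]) auto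
    also have "\<dots> \<le> (\<Sum>k\<in>{1..K}. 9 * sqrt (real d * t / real n) * sqrt (pmf pY k))"
      by (intro sum_mono weighted)
    also have "\<dots> \<le> 9 * sqrt (real d * t / real n) * sqrt (real K)"
      unfolding sum_distrib_left[symmetric] using t A
      by (intro mult_left_mono sum_sqrt_pmf_le supp) auto
    also have "\<dots> = 9 * sqrt (real K * real d / real n) * sqrt t"
      by (simp add: real_sqrt_divide real_sqrt_mult)
    also have "\<dots> \<le> 9 * sqrt (real K * real d / real n) * sqrt (4 * ln M)"
      using ln_rate_le[of d K n B \<delta>] A by (intro mult_left_mono) (auto simp: t_def M_def)
    also have "\<dots> = 18 * sqrt (real K * real d / real n) * ln M powr (1 / 2)"
      using A by (simp add: real_sqrt_mult powr_half_sqrt M_def)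
    finally show ?thesis .
  qed
  with E prob show "\<exists>A\<in>sets (sample_dist n d K pstar pY).
      measure (sample_dist n d K pstar pY) A \<ge> 1 - \<delta> \<and>
      (\<forall>S\<in>A. avg_TV d pY (phat S) pstar \<le> 18 * sqrt (real K * real d / real n) *
         ln (2 + real n + real K + real d + B + 1 / \<delta>) powr (1 / 2))"
    unfolding M_def by (intro bexI[of _ E]) auto
qed auto

end
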